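(* Let $s,w:(0,\infty)\to(0,\infty)$ be nondecreasing, with $s$ locally integrable on $[0,\infty)$, and let $K:(0,\infty)\times(0,\infty)\to\mathbb{C}$ be continuous with $$|K(x,y)|\lesssim \min\{1,(s(x)w(y))^{-1/2}\},\qquad x,y>0.$$ For $f$ as described in the context put $Ff(y)=\int_0^\infty s(x)f(x)K(x,y)\,dx$, $y>0$. Let $1<p\le q<\infty$ and let $u,v$ be nonnegative measurable functions on $(0,\infty)$. Assume that $s(x)w(1/x)\asymp1$ for $x>0$, and that there exists $C>0$ such that $$\sup_{r>0}\Bigg[\bigg(\int_0^r v(x)^{1-p'}\,dx+s(r)^{p'/2}\int_r^\infty v(x)^{1-p'}s(x)^{-p'/2}\,dx\bigg)^{1/p'}\bigg(w(1/r)^{q/2}\int_{1/r}^\infty u(y)w(y)^{-q/2}\,dy+\int_0^{1/r}u(y)\,dy\bigg)^{1/q}\Bigg]\le C.$$ Then the inequality $\Vert Ff\Vert_{q,u}\lesssim\Vert sf\Vert_{p,v}$ holds for every such measurable $f$, with a constant independent of $f$.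
   Context: Notation: for $0<p<\infty$ and a nonnegative measurable function $v$ on $(0,\infty)$, $\Vert f\Vert_{p,v}=\big(\int_0^\infty v(x)|f(x)|^p\,dx\big)^{1/p}$ (possibly $+\infty$); $p'=p/(p-1)$. $A\lesssim B$ means $A\le cB$ with a constant $c>0$ independent of the essential variables ($x,y,f$); $A\asymp B$ means $A\lesssim B\lesssim A$. Conventions: $0\cdot\infty=0$, and $v^{1-p'}=\infty$ where $v=0$. Functions $f$: $f:(0,\infty)\to\mathbb{C}$ is measurable and satisfies $\int_0^1 s(x)|f(x)|\,dx+\int_1^\infty s(x)^{1/2}|f(x)|\,dx<\infty$, so that $Ff(y)$ is well defined for every $y>0$. *)

theory Defs
  imports "HOL-Analysis.Analysis"
begin

text \<open>
  Real powers of extended nonnegative reals, with the conventions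
  \<open>0\<close> to a negative power is \<open>\<infinity>\<close> and \<open>\<infinity>\<close> to a negative power is \<open>0\<close>.
  (On the reals, \<open>0 powr a = 0\<close> for every \<open>a\<close>, which is not what is wanted for
  the weight \<open>v\<close> raised to the negative power \<open>1 - p'\<close>.)  The convention
  \<open>0 \<cdot> \<infinity> = 0\<close> is the one of multiplication on \<^typ>\<open>ennreal\<close>.
\<close>

definition ennpow :: "ennreal \<Rightarrow> real \<Rightarrow> ennreal" where
  "ennpow x a =
     (if a = 0 then 1
      else if x = 0 then (if a < 0 then \<infinity> else 0)
      else if x = \<infinity> then (if a < 0 then 0 else \<infinity>)
      else ennreal (enn2real x powr a))"

definition conj_exp :: "real \<Rightarrow> real" where
  "conj_exp p = p / (p - 1)"

text \<open>
  Functions on \<open>(0, \<infinity>)\<close> are represented by total functions on \<^typ>\<open>real\<close>; their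
  values outside \<^term>\<open>{0<..} :: real set\<close> are irrelevant.
\<close>

definition wnorm :: "real \<Rightarrow> (real \<Rightarrow> real) \<Rightarrow> (real \<Rightarrow> complex) \<Rightarrow> ennreal" where
  "wnorm p v f =
     ennpow (\<integral>\<^sup>+x\<in>{0<..}. ennreal (v x * norm (f x) powr p) \<partial>lebesgue) (1 / p)"

definition admissible :: "(real \<Rightarrow> real) \<Rightarrow> (real \<Rightarrow> complex) \<Rightarrow> bool" where
  "admissible s f \<longleftrightarrow>
     f \<in> borel_measurable (lebesgue_on {0<..}) \<and>
     (\<integral>\<^sup>+x\<in>{0<..1}. ennreal (s x * norm (f x)) \<partial>lebesgue) +
     (\<integral>\<^sup>+x\<in>{1<..}. ennreal (s x powr (1/2) * norm (f x)) \<partial>lebesgue) < \<infinity>"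

definition Ftransform ::
    "(real \<Rightarrow> real) \<Rightarrow> (real \<Rightarrow> real \<Rightarrow> complex) \<Rightarrow> (real \<Rightarrow> complex) \<Rightarrow> real \<Rightarrow> complex" where
  "Ftransform s K f y = (LINT x:{0<..}|lebesgue. complex_of_real (s x) * f x * K x y)"

end

theory Submission
  imports Defs "HOL-Probability.Distribution_Functions"
begin

text \<open>
  Write \<open>g = \<bar>s f\<bar>\<close> and split the integral defining \<open>F f y\<close> at \<open>x = 1/y\<close>.  The bound on the
  kernel gives, up to a constant,
  \<open>\<bar>F f y\<bar> \<le> G\<^sub>1 y + w(y)\<^sup>-\<^sup>1\<^sup>/\<^sup>2 G\<^sub>2 y\<close>, where \<open>G\<^sub>1 y\<close> is the integral of \<open>g\<close> over
  \<open>(0, 1/y]\<close> and \<open>G\<^sub>2 y\<close> is the integral of \<open>s\<^sup>-\<^sup>1\<^sup>/\<^sup>2 g\<close> over \<open>(1/y, \<infinity>)\<close>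
  (\<open>norm_Ftransform_le\<close>).  So the claim follows from two weighted Hardy inequalities,
  \<open>hardy_lower\<close> with the weights \<open>v\<close> and \<open>u\<close>, and \<open>hardy_upper\<close> with the weights
  \<open>v s\<^sup>p\<^sup>/\<^sup>2\<close> and \<open>u w\<^sup>-\<^sup>q\<^sup>/\<^sup>2\<close>.  Each needs a condition on its pair of weights, and
  both conditions sit inside the assumed one: multiplying out its two brackets, the product of
  the two terms without factors \<open>s\<close> and \<open>w\<close> is the first condition, and the product of the
  two others is the second one times \<open>(s(r) w(1/r))\<^sup>1\<^sup>/\<^sup>2\<close>, which is bounded below.

  Both Hardy inequalities integrate \<open>g\<close> over sets that grow or shrink monotonically with a
  parameter, and they are two instances of \<open>hardy_nested\<close>, whose proof is a decomposition
  into dyadic levels of the inner integral, with Hoelder's inequality on each level.  It needs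
  sets of prescribed mass, which exist because Lebesgue measure has no atoms
  (\<open>mass_split\<close>), and finite inner integrals, which admissibility provides
  (\<open>admissible_mass_finite\<close>).
\<close>

section \<open>Powers of extended nonnegative reals\<close>

lemma ennpow_ennreal:
  assumes "0 \<le> x" "0 < a"
  shows "ennpow (ennreal x) a = ennreal (x powr a)"
  using assms by (auto simp: ennpow_def)

lemma ennpow_ennreal_pos: "0 < x \<Longrightarrow> ennpow (ennreal x) a = ennreal (x powr a)"
  by (auto simp: ennpow_def)

lemma ennpow_zero: "0 < a \<Longrightarrow> ennpow 0 a = 0"
  by (simp add: ennpow_def)

lemma ennpow_top: "0 < a \<Longrightarrow> ennpow \<infinity> a = \<infinity>"
  by (simp add: ennpow_def)

lemma ennpow_mono:
  assumes "x \<le> y" "0 < a"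
  shows "ennpow x a \<le> ennpow y a"
proof (cases x; cases y)
  fix r t assume "x = ennreal r" "0 \<le> r" "y = ennreal t" "0 \<le> t"
  with assms show ?thesis
    by (auto simp: ennpow_ennreal intro!: ennreal_leI powr_mono2)
qed (use assms in \<open>auto simp: ennpow_top[simplified] top_unique\<close>)

lemma ennpow_measurable [measurable]:
  assumes [measurable]: "f \<in> borel_measurable M"
  shows "(\<lambda>x. ennpow (f x) a) \<in> borel_measurable M"
  unfolding ennpow_def by measurable

lemma ennpow_eq_0: "0 < a \<Longrightarrow> ennpow x a = 0 \<Longrightarrow> x = 0"
  by (cases x) (auto simp: ennpow_ennreal ennpow_top[simplified])

lemma ennpow_cmult:
  assumes "0 < c" "0 < a"
  shows "ennpow (ennreal c * x) a = ennreal (c powr a) * ennpow x a"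
proof (cases x)
  case (real r)
  then show ?thesis using assms
    by (simp add: ennpow_ennreal powr_mult flip: ennreal_mult)
next
  case top
  then show ?thesis using assms
    by (simp add: ennpow_top[simplified] ennreal_mult_top)
qed

lemma ennpow_ennpow:
  assumes "0 < a" "0 < b"
  shows "ennpow (ennpow x a) b = ennpow x (a * b)"
  using assms by (cases x) (auto simp: ennpow_ennreal powr_powr ennpow_top[simplified])

lemma ennpow_add_le:
  assumes "0 < B" "0 < a"
  shows "ennpow (ennreal B * (x + y)) a \<le> ennreal ((2 * B) powr a) * (ennpow x a + ennpow y a)"
proof -
  have "x + y \<le> 2 * max x y"
    by (metis add_mono max.cobounded1 max.cobounded2 mult_2)
  then have "ennreal B * (x + y) \<le> ennreal B * (2 * max x y)" by (rule mult_left_mono) simp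
  also have "\<dots> = ennreal (2 * B) * max x y"
    using assms by (simp add: ennreal_mult mult_ac)
  finally have "ennpow (ennreal B * (x + y)) a \<le> ennpow (ennreal (2 * B) * max x y) a"
    by (rule ennpow_mono[OF _ \<open>0 < a\<close>])
  also have "\<dots> = ennreal ((2 * B) powr a) * ennpow (max x y) a"
    by (rule ennpow_cmult) (use assms in auto)
  also have "ennpow (max x y) a \<le> ennpow x a + ennpow y a"
    by (simp add: max_def)
  finally show ?thesis by (simp add: mult_left_mono)
qed

lemma conj_exp_props:
  assumes "1 < p"
  shows "1 < conj_exp p" "1 / p + 1 / conj_exp p = 1" "1 - conj_exp p < 0"
    "conj_exp p / p = conj_exp p - 1" "p * (1 - conj_exp p) = - conj_exp p"
  using assms by (auto simp: conj_exp_def field_simps)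

section \<open>The weighted Hoelder inequality\<close>

text \<open>
  This is Young's inequality for the product of \<open>e g v\<^sup>1\<^sup>/\<^sup>p\<close> and \<open>v\<^sup>-\<^sup>1\<^sup>/\<^sup>p / e\<close>.  Where
  \<open>v\<close> vanishes it still holds, since there the last term is infinite; this is what lets the
  degenerate weights through.
\<close>

lemma young_weighted:
  fixes g v e p :: real
  assumes p: "1 < p" and "0 \<le> g" "0 \<le> v" "0 < e"
  shows "ennreal g \<le> ennreal (e powr p / p) * ennreal (v * g powr p)
           + ennreal (e powr (- conj_exp p) / conj_exp p) * ennpow (ennreal v) (1 - conj_exp p)"
proof (cases "v = 0")
  case True
  then show ?thesis using conj_exp_props[OF p] \<open>0 < e\<close>
    by (auto simp: ennpow_def ennreal_mult_top)
next
  case False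
  define p' where "p' = conj_exp p"
  note c = conj_exp_props[OF p, folded p'_def]
  have v: "v > 0" using False assms by simp
  have "g = (e * g * v powr (1/p)) * (v powr (-1/p) / e)"
    using v assms by (simp add: powr_minus field_simps)
  also have "\<dots> \<le> (e * g * v powr (1/p)) powr p / p + (v powr (-1/p) / e) powr p' / p'"
    using p c v assms by (intro Youngs_inequality) auto
  also have "(e * g * v powr (1/p)) powr p = e powr p * (v * g powr p)"
    using p v assms by (simp add: powr_mult powr_powr)
  also have "(v powr (-1/p) / e) powr p' = e powr (-p') * v powr (1 - p')"
  proof -
    have "- (p' / p) = 1 - p'" using c(4) by simp
    then show ?thesis
      using v assms
      by (simp add: powr_divide powr_mult powr_powr powr_minus_divide powr_minus[of e] flip: powr_minus_divide)
         (simp add: powr_minus_divide powr_mult powr_powr field_simps flip: \<open>- (p' / p) = 1 - p'\<close>)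
  qed
  finally have "g \<le> e powr p / p * (v * g powr p) + e powr (-p') / p' * v powr (1-p')"
    by simp
  then have "ennreal g \<le> ennreal (e powr p / p * (v * g powr p) + e powr (-p') / p' * v powr (1-p'))"
    by (rule ennreal_leI)
  also have "\<dots> = ennreal (e powr p / p) * ennreal (v * g powr p)
           + ennreal (e powr (- p') / p') * ennreal (v powr (1-p'))"
    using p c v assms
    by (subst ennreal_plus) (auto simp del: times_divide_eq_left simp flip: ennreal_mult)
  also have "ennreal (v powr (1-p')) = ennpow (ennreal v) (1-p')"
    using v c by (simp add: ennpow_def)
  finally show ?thesis unfolding p'_def .
qed

text \<open>
  Optimising over the scale \<open>e\<close> turns the additive bound into a multiplicative one.  If both
  numbers are positive, the best \<open>e\<close> makes the two terms proportional to \<open>1/p\<close> and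
  \<open>1/p'\<close> with the same factor; if one of them is \<open>0\<close>, letting \<open>e\<close> tend to infinity
  or to \<open>0\<close> makes the other term vanish.
\<close>

lemma young_optimise:
  fixes a b c :: real
  assumes p: "1 < p" and "0 \<le> a" "0 \<le> b"
    and le: "\<And>e. 0 < e \<Longrightarrow> c \<le> e powr p / p * a + e powr (- conj_exp p) / conj_exp p * b"
  shows "c \<le> a powr (1/p) * b powr (1 / conj_exp p)"
proof -
  define p' where "p' = conj_exp p"
  note c = conj_exp_props[OF p, folded p'_def]
  note le = le[folded p'_def]
  consider "a = 0" | "b = 0" | "a > 0" "b > 0" using assms by fastforce
  then show ?thesis
  proof cases
    case 1
    \<comment> \<open>Let \<open>e\<close> tend to infinity.\<close>
    have "((\<lambda>e. e powr (-p') / p' * b) \<longlongrightarrow> 0 / p' * b) at_top"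
      using c by (intro tendsto_intros tendsto_neg_powr filterlim_ident) auto
    moreover have "eventually (\<lambda>e. c \<le> e powr (-p') / p' * b) at_top"
      using eventually_gt_at_top[of 0] by eventually_elim (use le 1 in auto)
    ultimately have "c \<le> 0 / p' * b"
      by (intro tendsto_lowerbound) auto
    then show ?thesis using 1 by simp
  next
    case 2
    \<comment> \<open>Let \<open>e\<close> tend to \<open>0\<close>; writing it as an inverse keeps the limit at infinity.\<close>
    have "((\<lambda>e. inverse e powr p / p * a) \<longlongrightarrow> 0 powr p / p * a) at_top"
      using p by (intro tendsto_intros tendsto_zero_powrI tendsto_inverse_0_at_top filterlim_ident)
        (auto intro!: eventually_mono[OF eventually_gt_at_top[of 0]] tendsto_inverse_0_at_top filterlim_ident)
    moreover have "eventually (\<lambda>e. c \<le> inverse e powr p / p * a) at_top"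
      using eventually_gt_at_top[of 0] by eventually_elim (use le 2 in force)
    ultimately have "c \<le> 0 powr p / p * a"
      by (intro tendsto_lowerbound) auto
    then show ?thesis using 2 p by simp
  next
    case 3
    \<comment> \<open>The solution of \<open>a e\<^sup>p = b e\<^sup>-\<^sup>p\<^sup>'\<close>, because \<open>p + p' = p p'\<close>.\<close>
    define e where "e = (b / a) powr (1 / (p * p'))"
    have "e > 0" using 3 by (simp add: e_def)
    have "e powr p = (b/a) powr (1/p')" "e powr (-p') = (b/a) powr (-1/p)"
      using p c by (simp_all add: e_def powr_powr)
    have conv: "1 - 1/p' = 1/p" "1 - 1/p = 1/p'" using c(2) by linarith+
    have "e powr p * a = a powr (1/p) * b powr (1/p')"
    proof -
      have "e powr p * a = b powr (1/p') * (a powr 1 / a powr (1/p'))"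
        using 3 \<open>e powr p = _\<close> by (simp add: powr_divide)
      also have "a powr 1 / a powr (1/p') = a powr (1/p)"
        by (simp only: powr_diff[symmetric] conv)
      finally show ?thesis by simp
    qed
    moreover have "e powr (-p') * b = a powr (1/p) * b powr (1/p')"
    proof -
      have "e powr (-p') * b = a powr (1/p) * (b powr 1 / b powr (1/p))"
        unfolding \<open>e powr (-p') = _\<close>
        using 3 by (simp add: powr_divide powr_minus field_simps)
      also have "b powr 1 / b powr (1/p) = b powr (1/p')"
        by (simp only: powr_diff[symmetric] conv)
      finally show ?thesis by simp
    qed
    ultimately have "c \<le> (1/p) * (a powr (1/p) * b powr (1/p')) + (1/p') * (a powr (1/p) * b powr (1/p'))"
      using le[OF \<open>e > 0\<close>] by (simp)
    also have "\<dots> = (1/p + 1/p') * (a powr (1/p) * b powr (1/p'))"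
      by (rule distrib_right[symmetric])
    finally show ?thesis using c(2) by (simp add: p'_def)
  qed
qed

text \<open>
  Integrating Young's inequality, instead of normalising the two factors, avoids a separate
  treatment of the zeros of \<open>v\<close>.  The integral of \<open>v\<close> to the power \<open>1 - p'\<close> has to be
  finite: if \<open>v\<close> vanishes on \<open>D\<close>, it is infinite and the other factor is \<open>0\<close>, and under
  the convention \<open>0 \<cdot> \<infinity> = 0\<close> the inequality would force \<open>g = 0\<close> almost everywhere
  on \<open>D\<close>.
\<close>

lemma holder_weighted:
  fixes g v :: "'a \<Rightarrow> real"
  assumes p: "1 < p"
    and [measurable]: "g \<in> borel_measurable M" "v \<in> borel_measurable M" "D \<in> sets M"
    and nn: "\<And>x. x \<in> space M \<Longrightarrow> 0 \<le> g x" "\<And>x. x \<in> space M \<Longrightarrow> 0 \<le> v x"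
    and a: "(\<integral>\<^sup>+x\<in>D. ennreal (v x * g x powr p) \<partial>M) = ennreal a" "0 \<le> a"
    and b: "(\<integral>\<^sup>+x\<in>D. ennpow (ennreal (v x)) (1 - conj_exp p) \<partial>M) = ennreal b" "0 \<le> b"
    and c: "(\<integral>\<^sup>+x\<in>D. ennreal (g x) \<partial>M) = ennreal c"
  shows "c \<le> a powr (1/p) * b powr (1 / conj_exp p)"
proof (rule young_optimise[OF p \<open>0 \<le> a\<close> \<open>0 \<le> b\<close>])
  fix e :: real assume e: "0 < e"
  let ?A = "e powr p / p" and ?B = "e powr (- conj_exp p) / conj_exp p"
  have nonneg: "0 \<le> ?A" "0 \<le> ?B" using p conj_exp_props[OF p] by auto
  have "ennreal c \<le> (\<integral>\<^sup>+x. ennreal ?A * (ennreal (v x * g x powr p) * indicator D x)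
      + ennreal ?B * (ennpow (ennreal (v x)) (1 - conj_exp p) * indicator D x) \<partial>M)"
    unfolding c[symmetric]
    by (intro nn_integral_mono) (use young_weighted[OF p _ _ e] nn in \<open>auto split: split_indicator\<close>)
  also have "\<dots> = ennreal ?A * ennreal a + ennreal ?B * ennreal b"
    by (subst nn_integral_add) (auto simp: nn_integral_cmult a b)
  also have "\<dots> = ennreal (?A * a + ?B * b)"
    using nonneg a b
    by (simp only: ennreal_mult ennreal_plus mult_nonneg_nonneg)
  finally show "c \<le> ?A * a + ?B * b"
    using nonneg a b
    by (subst (asm) ennreal_le_iff) (auto simp only: add_nonneg_nonneg mult_nonneg_nonneg)
qed

section \<open>Hardy's inequality over a nested family of sets\<close>

text \<open>
  Let \<open>G t\<close> be the integral of \<open>g\<close> over \<open>E t\<close> and cut the range of \<open>G\<close> into the levels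
  \<open>(2\<^sup>k, 2\<^sup>k\<^sup>+\<^sup>1]\<close>, \<open>k\<close> an integer.  Because \<open>G\<close> takes every positive value below one
  of its values, each nonempty level has a set \<open>E (z k)\<close> of mass exactly \<open>2\<^sup>k\<close>, and every
  \<open>t\<close> in that level satisfies \<open>E (z k) \<subseteq> E t\<close>.  The differences
  \<open>D k = E (z k) - E (z (k - 1))\<close> are pairwise disjoint and have mass \<open>2\<^sup>k\<^sup>-\<^sup>1\<close>.
  Hoelder's inequality on \<open>D k\<close> and the condition on the weights at \<open>z k\<close> bound the
  contribution of level \<open>k\<close> by \<open>(4 A)\<^sup>q a\<^sub>k\<^sup>q\<^sup>/\<^sup>p\<close>, where \<open>a\<^sub>k\<close> is the
  integral of \<open>v g\<^sup>p\<close> over \<open>D k\<close>.  Since \<open>q / p \<ge> 1\<close>, the sum over \<open>k\<close> is at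
  most \<open>(4 A)\<^sup>q\<close> times the power \<open>q / p\<close> of the sum of the \<open>a\<^sub>k\<close>.

  The degenerate cases of the condition do no harm.  On a level of positive measure the
  condition forces the integral of \<open>v\<close> to the power \<open>1 - p'\<close> to be finite, so that
  Hoelder's inequality applies; that integral cannot be \<open>0\<close>, since \<open>D k\<close> has positive
  mass, so the measure of the level is finite.
\<close>

lemma hardy_nested:
  fixes M :: "'a measure" and N :: "'b measure" and E :: "'b \<Rightarrow> 'a set" and g v :: "'a \<Rightarrow> real"
  assumes p: "1 < p" and pq: "p \<le> q" and A: "0 < A"
    and g [measurable]: "g \<in> borel_measurable M" and g_nonneg: "\<And>x. x \<in> space M \<Longrightarrow> 0 \<le> g x"
    and v [measurable]: "v \<in> borel_measurable M" and v_nonneg: "\<And>x. x \<in> space M \<Longrightarrow> 0 \<le> v x"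
    and E [measurable]: "\<And>t. t \<in> space N \<Longrightarrow> E t \<in> sets M"
    and chain: "\<And>t r. t \<in> space N \<Longrightarrow> r \<in> space N \<Longrightarrow> E t \<subseteq> E r \<or> E r \<subseteq> E t"
    and fin: "\<And>t. t \<in> space N \<Longrightarrow> (\<integral>\<^sup>+x\<in>E t. ennreal (g x) \<partial>M) < \<infinity>"
    and meas [measurable]: "(\<lambda>t. \<integral>\<^sup>+x\<in>E t. ennreal (g x) \<partial>M) \<in> borel_measurable N"
    and ivt: "\<And>t c. t \<in> space N \<Longrightarrow> 0 < c \<Longrightarrow> ennreal c < (\<integral>\<^sup>+x\<in>E t. ennreal (g x) \<partial>M) \<Longrightarrow>
        \<exists>r\<in>space N. (\<integral>\<^sup>+x\<in>E r. ennreal (g x) \<partial>M) = ennreal c"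
    and up [measurable]: "\<And>t. t \<in> space N \<Longrightarrow> {r \<in> space N. E t \<subseteq> E r} \<in> sets N"
    and cond: "\<And>t. t \<in> space N \<Longrightarrow>
        ennpow (\<integral>\<^sup>+x\<in>E t. ennpow (ennreal (v x)) (1 - conj_exp p) \<partial>M) (1 / conj_exp p)
          * ennpow (emeasure N {r \<in> space N. E t \<subseteq> E r}) (1 / q) \<le> ennreal A"
  shows "(\<integral>\<^sup>+t. ennpow (\<integral>\<^sup>+x\<in>E t. ennreal (g x) \<partial>M) q \<partial>N)
     \<le> ennreal ((4 * A) powr q) * ennpow (\<integral>\<^sup>+x. ennreal (v x * g x powr p) \<partial>M) (q / p)"
proof -
  define T where "T = (\<integral>\<^sup>+x. ennreal (v x * g x powr p) \<partial>M)"
  define G where "G t = (\<integral>\<^sup>+x\<in>E t. ennreal (g x) \<partial>M)" for t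
  define p' where "p' = conj_exp p"
  note c = conj_exp_props[OF p, folded p'_def]
  have q: "q > 1" using p pq by simp
  have G_meas [measurable]: "G \<in> borel_measurable N" unfolding G_def by measurable
  show ?thesis
  proof (cases "T = \<infinity>")
    case True
    then show ?thesis unfolding T_def[symmetric]
      using p q A by (simp add: ennpow_top[simplified] ennreal_mult_top)
  next
    case False
    then obtain \<tau> where \<tau>: "T = ennreal \<tau>" "0 \<le> \<tau>" by (cases T) auto
    define L where "L k = {t \<in> space N. ennreal (2 powr real_of_int k) < G t \<and> G t \<le> ennreal (2 powr real_of_int (k+1))}" for k :: int
    define P where "P k \<longleftrightarrow> (\<exists>t\<in>space N. G t = ennreal (2 powr real_of_int k))" for k :: int
    define z where "z k = (SOME t. t \<in> space N \<and> G t = ennreal (2 powr real_of_int k))" for k :: int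
    define D where "D k = (if P k then E (z k) - E (z (k - 1)) else {})" for k :: int
    define a where "a k = (\<integral>\<^sup>+x\<in>D k. ennreal (v x * g x powr p) \<partial>M)" for k
    \<comment> \<open>The power \<open>q / p\<close> of \<open>a k\<close> is bounded by \<open>a k\<close> times the power \<open>q / p - 1\<close>
      of the total \<open>\<tau>\<close>; with this constant the bound of each level is linear in \<open>a k\<close>.\<close>
    define K where "K = (4 * A) powr q * \<tau> powr (q / p - 1)"
    have L_meas [measurable]: "L k \<in> sets N" for k unfolding L_def by measurable
    have z: "z k \<in> space N" "G (z k) = ennreal (2 powr real_of_int k)" if "P k" for k
      using that someI_ex[of "\<lambda>t. t \<in> space N \<and> G t = ennreal (2 powr real_of_int k)"]
      unfolding P_def z_def by auto
    have P_level: "P k" if "t \<in> space N" "ennreal (2 powr real_of_int k) < G t" for t k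
      using ivt[OF that(1), of "2 powr real_of_int k"] that(2) by (auto simp: P_def G_def)
    have P_down: "P j" if "P k" "j < k" for j k
      by (rule P_level[OF z(1)[OF that(1)]]) (use that z(2)[OF that(1)] in \<open>auto intro!: ennreal_lessI\<close>)
    have G_less: "E t \<subseteq> E r" if "t \<in> space N" "r \<in> space N" "G t < G r" for t r
    proof -
      have "\<not> E r \<subseteq> E t"
      proof
        assume "E r \<subseteq> E t"
        then have "G r \<le> G t" unfolding G_def
          by (intro nn_integral_mono) (auto split: split_indicator)
        then show False using that(3) by simp
      qed
      then show ?thesis using chain that by blast
    qed
    have z_mono: "E (z j) \<subseteq> E (z k)" if "P k" "j \<le> k" for j k
    proof (cases "j = k")
      case False
      then have "P j" using P_down that by simp
      then show ?thesis using that False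
        by (intro G_less z) (auto simp: z intro!: ennreal_lessI)
    qed simp
    have D_meas [measurable]: "D k \<in> sets M" for k
      unfolding D_def using z(1) P_down[of k "k - 1"] by auto
    have D_disj: "D j \<inter> D k = {}" if "j < k" for j k
    proof (cases "P k")
      case True
      then have "P (k - 1)" by (rule P_down) simp
      then have "E (z j) \<subseteq> E (z (k - 1))" by (rule z_mono) (use that in simp)
      then show ?thesis by (auto simp: D_def)
    qed (simp add: D_def)
    have mass: "(\<integral>\<^sup>+x\<in>D k. ennreal (g x) \<partial>M) = ennreal (2 powr real_of_int (k - 1))" if "P k" for k
    proof -
      have Pk: "P (k - 1)" using that by (rule P_down) simp
      have [measurable]: "E (z k) \<in> sets M" "E (z (k - 1)) \<in> sets M" using z(1) that Pk by auto
      have "G (z k) = (\<integral>\<^sup>+x. ennreal (g x) * indicator (D k) x + ennreal (g x) * indicator (E (z (k-1))) x \<partial>M)"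
        unfolding G_def using z_mono[OF that, of "k - 1"] that
        by (intro nn_integral_cong) (auto simp: D_def split: split_indicator)
      also have "\<dots> = (\<integral>\<^sup>+x\<in>D k. ennreal (g x) \<partial>M) + G (z (k - 1))"
        unfolding G_def by (rule nn_integral_add) measurable
      finally have "ennreal (2 powr real_of_int k) =
          (\<integral>\<^sup>+x\<in>D k. ennreal (g x) \<partial>M) + ennreal (2 powr real_of_int (k - 1))"
        using z that Pk by simp
      moreover have "ennreal (2 powr real_of_int k) =
          ennreal (2 powr real_of_int (k - 1)) + ennreal (2 powr real_of_int (k - 1))"
        by (simp add: powr_diff flip: ennreal_plus)
      ultimately show ?thesis
        by (simp add: ennreal_add_left_cancel add.commute)
    qed
    have aT: "a k \<le> T" for k
      unfolding a_def T_def by (intro nn_integral_mono) (auto split: split_indicator)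
    have level: "ennreal ((2 powr real_of_int (k + 1)) powr q) * emeasure N (L k) \<le> ennreal K * a k" for k
    proof (cases "emeasure N (L k) = 0")
      case False
      then obtain t where "t \<in> L k" by (metis emeasure_empty ex_in_conv)
      then have Pk: "P k" using P_level by (auto simp: L_def)
      define U where "U = {r \<in> space N. E (z k) \<subseteq> E r}"
      define V where "V = (\<integral>\<^sup>+x\<in>E (z k). ennpow (ennreal (v x)) (1 - p') \<partial>M)"
      have "L k \<subseteq> U" unfolding L_def U_def using G_less[OF z(1)[OF Pk]] z(2)[OF Pk] by auto
      then have LU: "emeasure N (L k) \<le> emeasure N U"
        using up[OF z(1)[OF Pk]] by (intro emeasure_mono) (auto simp: U_def)
      then have U0: "emeasure N U \<noteq> 0" using False by auto
      have cnd: "ennpow V (1 / p') * ennpow (emeasure N U) (1 / q) \<le> ennreal A"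
        using cond[OF z(1)[OF Pk]] by (simp add: U_def V_def p'_def)
      \<comment> \<open>The second factor of the condition is not \<open>0\<close>, so the first one is not infinite.\<close>
      have "V \<noteq> \<infinity>"
      proof
        assume "V = \<infinity>"
        moreover have "ennpow (emeasure N U) (1 / q) \<noteq> 0" using U0 ennpow_eq_0[of "1/q"] q by auto
        ultimately show False using cnd c(1) ennpow_top[of "1/p'"] by (auto simp: ennreal_top_mult top_unique)
      qed
      obtain \<alpha> where \<alpha>: "a k = ennreal \<alpha>" "0 \<le> \<alpha>" "\<alpha> \<le> \<tau>"
        using aT[of k] \<tau> by (cases "a k") (auto simp: top_unique)
      have "(\<integral>\<^sup>+x\<in>D k. ennpow (ennreal (v x)) (1 - p') \<partial>M) \<le> V"
        unfolding V_def by (intro nn_integral_mono) (auto simp: D_def split: split_indicator if_splits)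
      then obtain \<beta>0 \<beta> where \<beta>: "(\<integral>\<^sup>+x\<in>D k. ennpow (ennreal (v x)) (1 - p') \<partial>M) = ennreal \<beta>0" "0 \<le> \<beta>0"
          "V = ennreal \<beta>" "\<beta>0 \<le> \<beta>"
        using \<open>V \<noteq> \<infinity>\<close>
        by (cases "\<integral>\<^sup>+x\<in>D k. ennpow (ennreal (v x)) (1 - p') \<partial>M"; cases V) (auto simp: top_unique)
      have "2 powr real_of_int (k - 1) \<le> \<alpha> powr (1/p) * \<beta>0 powr (1 / p')"
        unfolding p'_def
        by (rule holder_weighted[OF p g v D_meas g_nonneg v_nonneg _ _ _ _ mass[OF Pk]])
          (use \<alpha> \<beta> in \<open>auto simp: a_def p'_def\<close>)
      also have "\<dots> \<le> \<alpha> powr (1/p) * \<beta> powr (1 / p')"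
        using \<beta> c(1) by (intro mult_left_mono powr_mono2) auto
      finally have H: "2 powr real_of_int (k - 1) \<le> \<alpha> powr (1/p) * \<beta> powr (1 / p')" .
      then have "0 < \<alpha> powr (1/p) * \<beta> powr (1 / p')"
        by (rule less_le_trans[rotated]) simp
      then have pos: "\<alpha> > 0" "\<beta> > 0" using \<alpha> \<beta> by (auto simp: less_le)
      have "emeasure N U \<noteq> \<infinity>"
      proof
        assume "emeasure N U = \<infinity>"
        moreover have "ennpow V (1/p') \<noteq> 0" using pos \<beta> c(1) by (auto simp: ennpow_ennreal)
        ultimately show False using cnd q ennpow_top[of "1/q"] by (auto simp: ennreal_mult_top top_unique)
      qed
      then obtain \<mu> where \<mu>: "emeasure N U = ennreal \<mu>" "0 \<le> \<mu>" by (cases "emeasure N U") auto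
      have "\<beta> powr (1/p') * \<mu> powr (1/q) \<le> A"
        using cnd \<mu> \<beta> pos c(1) q A by (simp add: ennpow_ennreal flip: ennreal_mult)
      then have cnd': "(\<beta> powr (1/p') * \<mu> powr (1/q)) powr q \<le> A powr q"
        using q by (intro powr_mono2) auto
      have "(2 powr real_of_int (k + 1)) powr q * \<mu> = (4 * 2 powr real_of_int (k - 1)) powr q * (\<mu> powr (1/q)) powr q"
        using \<mu> q by (simp add: powr_add powr_diff powr_powr mult.commute)
      also have "\<dots> \<le> (4 * (\<alpha> powr (1/p) * \<beta> powr (1 / p'))) powr q * (\<mu> powr (1/q)) powr q"
        using H q by (intro mult_right_mono powr_mono2) auto
      also have "\<dots> = 4 powr q * \<alpha> powr (q/p) * (\<beta> powr (1/p') * \<mu> powr (1/q)) powr q"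
        by (simp add: powr_mult powr_powr)
      also have "\<dots> \<le> 4 powr q * \<alpha> powr (q/p) * A powr q"
        by (intro mult_left_mono cnd') auto
      also have "\<alpha> powr (q/p) = \<alpha> powr (q/p - 1) * \<alpha>"
        using pos by (simp add: powr_diff)
      also have "4 powr q * (\<alpha> powr (q/p - 1) * \<alpha>) * A powr q = (4 * A) powr q * \<alpha> powr (q/p - 1) * \<alpha>"
        using A by (simp add: powr_mult)
      also have "\<dots> \<le> K * \<alpha>" unfolding K_def
        using pos \<alpha> p pq by (intro mult_left_mono mult_right_mono powr_mono2) auto
      finally have "(2 powr real_of_int (k + 1)) powr q * \<mu> \<le> K * \<alpha>" .
      moreover have "0 \<le> K" by (simp add: K_def)
      ultimately have "ennreal ((2 powr real_of_int (k + 1)) powr q) * ennreal \<mu> \<le> ennreal K * ennreal \<alpha>"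
        using \<mu> \<alpha> by (simp add: ennreal_leI flip: ennreal_mult)
      then show ?thesis
        using order_trans[OF mult_left_mono[OF LU zero_le]] \<mu> \<alpha> by simp
    qed simp
    \<comment> \<open>Series are indexed by natural numbers, so the levels are enumerated.\<close>
    let ?d = int_decode
    have pointwise: "ennpow (G t) q \<le>
        (\<Sum>n. ennreal ((2 powr real_of_int (?d n + 1)) powr q) * indicator (L (?d n)) t)"
      if t: "t \<in> space N" for t
    proof (cases "G t = 0")
      case True
      then show ?thesis using q by (simp add: ennpow_zero)
    next
      case False
      then obtain \<gamma> where \<gamma>: "G t = ennreal \<gamma>" "0 < \<gamma>"
        using fin[OF t] by (cases "G t") (auto simp: G_def[symmetric] less_le)
      define k where "k = \<lceil>log 2 \<gamma>\<rceil> - 1"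
      have k: "real_of_int k < log 2 \<gamma>" "log 2 \<gamma> \<le> real_of_int (k + 1)"
        unfolding k_def by linarith+
      have \<gamma>k: "2 powr real_of_int k < \<gamma>" "\<gamma> \<le> 2 powr real_of_int (k + 1)"
        using k \<gamma> less_log_iff[of 2 \<gamma> "real_of_int k"] log_le_iff[of 2 \<gamma> "real_of_int (k+1)"] by auto
      then have "t \<in> L k" using t \<gamma> by (auto simp: L_def intro!: ennreal_lessI ennreal_leI)
      moreover have "ennpow (G t) q \<le> ennreal ((2 powr real_of_int (k + 1)) powr q)"
        using \<gamma> \<gamma>k q by (auto simp: ennpow_ennreal intro!: ennreal_leI powr_mono2)
      ultimately have "ennpow (G t) q \<le>
          (\<Sum>n\<in>{int_encode k}. ennreal ((2 powr real_of_int (?d n + 1)) powr q) * indicator (L (?d n)) t)"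
        by simp
      also have "\<dots> \<le> (\<Sum>n. ennreal ((2 powr real_of_int (?d n + 1)) powr q) * indicator (L (?d n)) t)"
        by (intro sum_le_suminf summableI) auto
      finally show ?thesis .
    qed
    have disj: "disjoint_family (\<lambda>n. D (?d n))"
      unfolding disjoint_family_on_def
    proof (intro ballI impI)
      fix m n :: nat assume "m \<noteq> n"
      then have "?d m \<noteq> ?d n" by (simp add: inj_eq[OF inj_int_decode])
      then show "D (?d m) \<inter> D (?d n) = {}"
        using D_disj[of "?d m" "?d n"] D_disj[of "?d n" "?d m"] by (auto simp: neq_iff)
    qed
    have "(\<integral>\<^sup>+t. ennpow (G t) q \<partial>N) \<le>
        (\<integral>\<^sup>+t. (\<Sum>n. ennreal ((2 powr real_of_int (?d n + 1)) powr q) * indicator (L (?d n)) t) \<partial>N)"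
      by (intro nn_integral_mono pointwise)
    also have "\<dots> = (\<Sum>n. ennreal ((2 powr real_of_int (?d n + 1)) powr q) * emeasure N (L (?d n)))"
      by (subst nn_integral_suminf) (auto simp: nn_integral_cmult_indicator)
    also have "\<dots> \<le> (\<Sum>n. ennreal K * a (?d n))"
      by (intro suminf_le summableI level)
    also have "\<dots> = ennreal K * (\<Sum>n. a (?d n))" by simp
    also have "(\<Sum>n. a (?d n)) = (\<integral>\<^sup>+x. (\<Sum>n. ennreal (v x * g x powr p) * indicator (D (?d n)) x) \<partial>M)"
      unfolding a_def by (rule nn_integral_suminf[symmetric]) measurable
    also have "\<dots> \<le> T" unfolding T_def
      using disj by (intro nn_integral_mono) (auto simp: suminf_indicator split: split_indicator)
    also have "ennreal K * T = ennreal ((4 * A) powr q * \<tau> powr (q / p))"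
      using \<tau> by (cases "\<tau> = 0") (auto simp: K_def powr_diff simp flip: ennreal_mult)
    also have "\<dots> = ennreal ((4 * A) powr q) * ennpow T (q / p)"
      using \<tau> p q by (simp add: ennpow_ennreal ennreal_mult)
    finally show ?thesis unfolding G_def T_def by (simp add: mult_left_mono)
  qed
qed

section \<open>Two Hardy inequalities on the half-line\<close>

text \<open>
  The measure with density \<open>\<phi>\<close> is finite and has no atoms, so its distribution function is
  continuous and runs from \<open>0\<close> to the total mass.
\<close>

lemma mass_split:
  fixes \<phi> :: "real \<Rightarrow> ennreal"
  assumes [measurable]: "\<phi> \<in> borel_measurable lebesgue"
    and fin: "(\<integral>\<^sup>+x. \<phi> x \<partial>lebesgue) < \<infinity>"
    and c: "0 < c" "ennreal c < (\<integral>\<^sup>+x. \<phi> x \<partial>lebesgue)"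
  obtains t where "(\<integral>\<^sup>+x\<in>{..t}. \<phi> x \<partial>lebesgue) = ennreal c"
proof -
  define \<mu> where "\<mu> = distr (density lebesgue \<phi>) borel (\<lambda>x. x)"
  have [measurable]: "(\<lambda>x::real. x) \<in> measurable lebesgue borel"
    by (simp add: measurable_completion)
  have \<mu>: "emeasure \<mu> S = (\<integral>\<^sup>+x\<in>S. \<phi> x \<partial>lebesgue)" if "S \<in> sets borel" for S
  proof -
    have S: "S \<in> sets lebesgue" by (rule sets_completionI_sets) (simp add: that)
    have "emeasure \<mu> S = emeasure (density lebesgue \<phi>) S"
      unfolding \<mu>_def by (subst emeasure_distr) (simp_all add: that measurable_completion)
    also have "\<dots> = (\<integral>\<^sup>+x\<in>S. \<phi> x \<partial>lebesgue)"
      by (rule emeasure_density) (use S in simp_all)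
    finally show ?thesis .
  qed
  have total: "emeasure \<mu> (space \<mu>) = (\<integral>\<^sup>+x. \<phi> x \<partial>lebesgue)"
    using \<mu>[of UNIV] by (simp add: \<mu>_def)
  interpret finite_borel_measure \<mu>
  proof (intro finite_borel_measure.intro finite_borel_measure_axioms.intro finite_measureI)
    show "emeasure \<mu> (space \<mu>) \<noteq> \<infinity>" unfolding total using fin by simp
    show "sets \<mu> = sets borel" by (simp add: \<mu>_def)
  qed
  have "measure \<mu> {x} = 0" for x
  proof -
    have "(\<integral>\<^sup>+y. \<phi> y * indicator {x} y \<partial>lebesgue) = (\<integral>\<^sup>+(y::real). 0 \<partial>lebesgue)"
      by (intro nn_integral_cong_AE eventually_mono[OF AE_completion[OF AE_lborel_singleton[of x]]])
        (auto split: split_indicator)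
    then show ?thesis using \<mu>[of "{x}"] by (simp add: measure_def)
  qed
  then have cont: "isCont (cdf \<mu>) x" for x by (simp add: isCont_cdf)
  have "c < measure \<mu> (space \<mu>)"
    using c total by (metis emeasure_eq_measure ennreal_less_iff less_imp_le)
  then obtain hi where hi: "c < cdf \<mu> hi"
    using eventually_happens'[OF _ order_tendstoD(1)[OF cdf_lim_at_top]] by (metis trivial_limit_at_top_linorder)
  obtain lo where lo: "cdf \<mu> lo < c"
    using eventually_happens'[OF _ order_tendstoD(2)[OF cdf_lim_at_bot c(1)]] by (metis trivial_limit_at_bot_linorder)
  have "lo \<le> hi" using cdf_nondecreasing[of hi lo] lo hi by linarith
  then obtain t where "cdf \<mu> t = c"
    using IVT[of "cdf \<mu>" lo c hi] lo hi cont by auto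
  then have "(\<integral>\<^sup>+x\<in>{..t}. \<phi> x \<partial>lebesgue) = ennreal c"
    using \<mu>[of "{..t}"] emeasure_eq_measure by (simp add: cdf_def)
  then show thesis by (rule that)
qed

lemma borel_measurable_monotone_ennreal:
  fixes H :: "real \<Rightarrow> ennreal"
  assumes "mono H \<or> antimono H"
  shows "H \<in> borel_measurable borel"
proof (rule borel_measurableI_le)
  fix c
  have "is_interval {x. H x \<le> c}"
    using assms unfolding is_interval_1 mono_def antimono_def by (auto intro: order_trans)
  then show "{x \<in> space borel. H x \<le> c} \<in> sets borel"
    by (simp add: real_interval_borel_measurable)
qed

lemma borel_imp_lebesgue_on_measurable:
  fixes H :: "real \<Rightarrow> 'a::topological_space"
  assumes "H \<in> borel_measurable (restrict_space borel S)"
  shows "H \<in> borel_measurable (lebesgue_on S)"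
proof -
  have "(\<lambda>x. x) \<in> measurable (lebesgue_on S) (restrict_space borel S)"
    by (intro measurable_restrict_space3) (auto simp: measurable_completion)
  from measurable_compose[OF this assms] show ?thesis .
qed

lemma nn_integral_lebesgue_on_subset:
  assumes "S \<in> sets lebesgue" "D \<subseteq> S"
  shows "(\<integral>\<^sup>+x\<in>D. f x \<partial>lebesgue_on S) = (\<integral>\<^sup>+x\<in>D. f x \<partial>lebesgue)"
  using assms by (subst nn_integral_restrict_space) (auto intro!: nn_integral_cong split: split_indicator)

text \<open>
  Here the outer measure has density \<open>u\<close>, which turns the measure of
  \<open>{r. E t \<subseteq> E r}\<close> into an integral of \<open>u\<close>.
\<close>

lemma hardy_nested_halfline:
  fixes E :: "real \<Rightarrow> real set" and g u v :: "real \<Rightarrow> real"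
  assumes p: "1 < p" and pq: "p \<le> q" and A: "0 < A"
    and g [measurable]: "g \<in> borel_measurable (lebesgue_on {0<..})" and g_nonneg: "\<And>x. x > 0 \<Longrightarrow> 0 \<le> g x"
    and v [measurable]: "v \<in> borel_measurable (lebesgue_on {0<..})" and v_nonneg: "\<And>x. x > 0 \<Longrightarrow> 0 \<le> v x"
    and u [measurable]: "u \<in> borel_measurable (lebesgue_on {0<..})"
    and E: "\<And>t. t > 0 \<Longrightarrow> E t \<in> sets lebesgue" "\<And>t. t > 0 \<Longrightarrow> E t \<subseteq> {0<..}"
    and chain: "\<And>t r. t > 0 \<Longrightarrow> r > 0 \<Longrightarrow> E t \<subseteq> E r \<or> E r \<subseteq> E t"
    and fin: "\<And>t. t > 0 \<Longrightarrow> (\<integral>\<^sup>+x\<in>E t. ennreal (g x) \<partial>lebesgue) < \<infinity>"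
    and meas [measurable]: "(\<lambda>t. \<integral>\<^sup>+x\<in>E t. ennreal (g x) \<partial>lebesgue) \<in> borel_measurable (lebesgue_on {0<..})"
    and ivt: "\<And>t c. t > 0 \<Longrightarrow> 0 < c \<Longrightarrow> ennreal c < (\<integral>\<^sup>+x\<in>E t. ennreal (g x) \<partial>lebesgue) \<Longrightarrow>
        \<exists>r>0. (\<integral>\<^sup>+x\<in>E r. ennreal (g x) \<partial>lebesgue) = ennreal c"
    and up: "\<And>t. t > 0 \<Longrightarrow> {r \<in> {0<..}. E t \<subseteq> E r} \<in> sets lebesgue"
    and cond: "\<And>t. t > 0 \<Longrightarrow>
        ennpow (\<integral>\<^sup>+x\<in>E t. ennpow (ennreal (v x)) (1 - conj_exp p) \<partial>lebesgue) (1 / conj_exp p)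
          * ennpow (\<integral>\<^sup>+y\<in>{r \<in> {0<..}. E t \<subseteq> E r}. ennreal (u y) \<partial>lebesgue) (1 / q) \<le> ennreal A"
  shows "(\<integral>\<^sup>+t\<in>{0<..}. ennreal (u t) * ennpow (\<integral>\<^sup>+x\<in>E t. ennreal (g x) \<partial>lebesgue) q \<partial>lebesgue)
     \<le> ennreal ((4 * A) powr q) * ennpow (\<integral>\<^sup>+x\<in>{0<..}. ennreal (v x * g x powr p) \<partial>lebesgue) (q / p)"
proof -
  let ?M = "lebesgue_on {0<..} :: real measure"
  let ?N = "density ?M (\<lambda>y. ennreal (u y))"
  have sub: "(\<integral>\<^sup>+x\<in>E t. f x \<partial>?M) = (\<integral>\<^sup>+x\<in>E t. f x \<partial>lebesgue)" if "t > 0" for t f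
    using E[OF that] by (intro nn_integral_lebesgue_on_subset) auto
  have all: "(\<integral>\<^sup>+x. f x \<partial>?M) = (\<integral>\<^sup>+x\<in>{0<..}. f x \<partial>lebesgue)" for f :: "real \<Rightarrow> ennreal"
    by (simp add: nn_integral_restrict_space)
  have meas': "(\<lambda>t. \<integral>\<^sup>+x\<in>E t. ennreal (g x) \<partial>?M) \<in> borel_measurable ?M"
    using meas by (rule measurable_cong[THEN iffD2, rotated]) (simp add: sub)
  have upM: "{r \<in> {0<..}. E t \<subseteq> E r} \<in> sets ?M" if "t > 0" for t
    using up[OF that] by (auto simp: sets_restrict_space image_iff intro!: bexI[of _ "{r \<in> {0<..}. E t \<subseteq> E r}"])
  have em: "emeasure ?N {r \<in> {0<..}. E t \<subseteq> E r} = (\<integral>\<^sup>+y\<in>{r \<in> {0<..}. E t \<subseteq> E r}. ennreal (u y) \<partial>lebesgue)"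
    if "t > 0" for t
    using upM[OF that] by (subst emeasure_density) (auto intro!: nn_integral_lebesgue_on_subset)
  have "(\<integral>\<^sup>+t. ennpow (\<integral>\<^sup>+x\<in>E t. ennreal (g x) \<partial>?M) q \<partial>?N)
     \<le> ennreal ((4 * A) powr q) * ennpow (\<integral>\<^sup>+x. ennreal (v x * g x powr p) \<partial>?M) (q / p)"
  proof (rule hardy_nested[OF p pq A g _ v])
    show "E t \<in> sets ?M" if "t \<in> space ?N" for t
      using E that by (auto simp: sets_restrict_space image_iff Int_absorb1 intro!: bexI[of _ "E t"])
    show "\<exists>r\<in>space ?N. (\<integral>\<^sup>+x\<in>E r. ennreal (g x) \<partial>?M) = ennreal c"
      if "t \<in> space ?N" "0 < c" "ennreal c < (\<integral>\<^sup>+x\<in>E t. ennreal (g x) \<partial>?M)" for t c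
      using ivt[of t c] that sub by auto
  qed (use g_nonneg v_nonneg chain fin meas' upM cond em in \<open>auto simp: sub\<close>)
  also have "(\<integral>\<^sup>+t. ennpow (\<integral>\<^sup>+x\<in>E t. ennreal (g x) \<partial>?M) q \<partial>?N)
      = (\<integral>\<^sup>+t. ennreal (u t) * ennpow (\<integral>\<^sup>+x\<in>E t. ennreal (g x) \<partial>?M) q \<partial>?M)"
    using meas' by (intro nn_integral_density) measurable
  also have "\<dots> = (\<integral>\<^sup>+t. ennreal (u t) * ennpow (\<integral>\<^sup>+x\<in>E t. ennreal (g x) \<partial>lebesgue) q \<partial>?M)"
    by (intro nn_integral_cong) (simp add: sub)
  finally show ?thesis unfolding all .
qed

lemma restrict_halfline_measurable:
  fixes g :: "real \<Rightarrow> real"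
  assumes "g \<in> borel_measurable (lebesgue_on {0<..})" "D \<in> sets lebesgue" "D \<subseteq> {0<..}"
  shows "(\<lambda>x. ennreal (g x) * indicator D x) \<in> borel_measurable lebesgue"
proof -
  have "(\<lambda>x. indicator {0<..} x *\<^sub>R g x) \<in> borel_measurable lebesgue"
    using assms by (subst (asm) borel_measurable_restrict_space_iff) auto
  then have "(\<lambda>x. ennreal (indicator {0<..} x *\<^sub>R g x) * indicator D x) \<in> borel_measurable lebesgue"
    using assms by measurable
  also have "(\<lambda>x. ennreal (indicator {0<..} x *\<^sub>R g x) * indicator D x) = (\<lambda>x. ennreal (g x) * indicator D x)"
    using assms(3) by (auto simp: fun_eq_iff split: split_indicator)
  finally show ?thesis .
qed

lemma reciprocal_lebesgue_measurable:
  fixes H :: "real \<Rightarrow> ennreal"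
  assumes "mono H \<or> antimono H"
  shows "(\<lambda>y. H (1 / y)) \<in> borel_measurable (lebesgue_on {0<..})"
proof -
  have [measurable]: "H \<in> borel_measurable borel" using assms by (rule borel_measurable_monotone_ennreal)
  have "(\<lambda>y::real. H (1 / y)) \<in> borel_measurable borel" by measurable
  then show ?thesis by (intro borel_imp_lebesgue_on_measurable measurable_restrict_space1)
qed

text \<open>
  For \<open>E t = (0, 1/t]\<close> the inclusion \<open>E t \<subseteq> E r\<close> means \<open>r \<le> t\<close>.
\<close>

lemma hardy_lower:
  fixes g u v :: "real \<Rightarrow> real"
  assumes p: "1 < p" and pq: "p \<le> q" and A: "0 < A"
    and g: "g \<in> borel_measurable (lebesgue_on {0<..})" and g_nonneg: "\<And>x. x > 0 \<Longrightarrow> 0 \<le> g x"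
    and v: "v \<in> borel_measurable (lebesgue_on {0<..})" and v_nonneg: "\<And>x. x > 0 \<Longrightarrow> 0 \<le> v x"
    and u: "u \<in> borel_measurable (lebesgue_on {0<..})"
    and fin: "\<And>r. r > 0 \<Longrightarrow> (\<integral>\<^sup>+x\<in>{0<..r}. ennreal (g x) \<partial>lebesgue) < \<infinity>"
    and cond: "\<And>r. r > 0 \<Longrightarrow>
        ennpow (\<integral>\<^sup>+x\<in>{0<..r}. ennpow (ennreal (v x)) (1 - conj_exp p) \<partial>lebesgue) (1 / conj_exp p)
          * ennpow (\<integral>\<^sup>+y\<in>{0<..1/r}. ennreal (u y) \<partial>lebesgue) (1 / q) \<le> ennreal A"
  shows "(\<integral>\<^sup>+y\<in>{0<..}. ennreal (u y) * ennpow (\<integral>\<^sup>+x\<in>{0<..1/y}. ennreal (g x) \<partial>lebesgue) q \<partial>lebesgue)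
     \<le> ennreal ((4 * A) powr q) * ennpow (\<integral>\<^sup>+x\<in>{0<..}. ennreal (v x * g x powr p) \<partial>lebesgue) (q / p)"
proof (rule hardy_nested_halfline[OF p pq A g g_nonneg v v_nonneg u])
  have "mono (\<lambda>r. \<integral>\<^sup>+x\<in>{0<..r}. ennreal (g x) \<partial>lebesgue)"
    by (intro monoI nn_integral_mono) (auto split: split_indicator)
  then show "(\<lambda>t. \<integral>\<^sup>+x\<in>{0<..1/t}. ennreal (g x) \<partial>lebesgue) \<in> borel_measurable (lebesgue_on {0<..})"
    using reciprocal_lebesgue_measurable[of "\<lambda>r. \<integral>\<^sup>+x\<in>{0<..r}. ennreal (g x) \<partial>lebesgue"] by simp
next
  fix y c :: real assume y: "0 < y" and c: "0 < c" "ennreal c < (\<integral>\<^sup>+x\<in>{0<..1/y}. ennreal (g x) \<partial>lebesgue)"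
  obtain t where t: "(\<integral>\<^sup>+x\<in>{..t}. (ennreal (g x) * indicator {0<..1/y} x) \<partial>lebesgue) = ennreal c"
  proof (rule mass_split[OF _ _ c])
    show "(\<lambda>x. ennreal (g x) * indicator {0<..1/y} x) \<in> borel_measurable lebesgue"
      by (rule restrict_halfline_measurable[OF g]) auto
  qed (use fin[of "1/y"] y in auto)
  have "0 < t"
  proof (rule ccontr)
    assume "\<not> 0 < t"
    then have "(\<integral>\<^sup>+x\<in>{..t}. (ennreal (g x) * indicator {0<..1/y} x) \<partial>lebesgue) = (\<integral>\<^sup>+(x::real). 0 \<partial>lebesgue)"
      by (intro nn_integral_cong) (auto split: split_indicator)
    then show False using t c by simp
  qed
  moreover have "t < 1 / y"
  proof (rule ccontr)
    assume "\<not> t < 1 / y"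
    then have "(\<integral>\<^sup>+x\<in>{..t}. (ennreal (g x) * indicator {0<..1/y} x) \<partial>lebesgue)
        = (\<integral>\<^sup>+x\<in>{0<..1/y}. ennreal (g x) \<partial>lebesgue)"
      by (intro nn_integral_cong) (auto split: split_indicator)
    then show False using t c by simp
  qed
  ultimately have "(\<integral>\<^sup>+x\<in>{0<..1/(1/t)}. ennreal (g x) \<partial>lebesgue)
      = (\<integral>\<^sup>+x\<in>{..t}. (ennreal (g x) * indicator {0<..1/y} x) \<partial>lebesgue)"
    by (intro nn_integral_cong) (auto split: split_indicator)
  then show "\<exists>r>0. (\<integral>\<^sup>+x\<in>{0<..1/r}. ennreal (g x) \<partial>lebesgue) = ennreal c"
    using \<open>0 < t\<close> t by (intro exI[of _ "1/t"]) auto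
next
  fix t :: real assume t: "0 < t"
  have "{0<..1/t} \<subseteq> {0<..1/r} \<longleftrightarrow> 1/t \<le> 1/r" for r
    using t by (auto simp: subset_iff intro: order_trans dest!: spec[of _ "1/t"])
  then have "{0<..1/t} \<subseteq> {0<..1/r} \<longleftrightarrow> r \<le> t" if "0 < r" for r
    using t that by (simp add: field_simps)
  then have "{r \<in> {0<..}. {0<..1/t} \<subseteq> {0<..1/r}} = {r \<in> {0<..}. r \<le> t}"
    by (metis (no_types, lifting) greaterThan_iff)
  also have "\<dots> = {0<..t}" by auto
  finally have eq: "{r \<in> {0<..}. {0<..1/t} \<subseteq> {0<..1/r}} = {0<..t}" .
  show "{r \<in> {0<..}. {0<..1/t} \<subseteq> {0<..1/r}} \<in> sets lebesgue" unfolding eq by simp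
  show "ennpow (\<integral>\<^sup>+x\<in>{0<..1/t}. ennpow (ennreal (v x)) (1 - conj_exp p) \<partial>lebesgue) (1 / conj_exp p)
      * ennpow (\<integral>\<^sup>+y\<in>{r \<in> {0<..}. {0<..1/t} \<subseteq> {0<..1/r}}. ennreal (u y) \<partial>lebesgue) (1 / q) \<le> ennreal A"
    unfolding eq using cond[of "1/t"] t by simp
qed (use fin in auto)

text \<open>
  For \<open>E t = (1/t, \<infinity>)\<close> the inclusion \<open>E t \<subseteq> E r\<close> means \<open>t \<le> r\<close>; the endpoint
  \<open>t\<close> has measure zero.
\<close>

lemma hardy_upper:
  fixes g u v :: "real \<Rightarrow> real"
  assumes p: "1 < p" and pq: "p \<le> q" and A: "0 < A"
    and g: "g \<in> borel_measurable (lebesgue_on {0<..})" and g_nonneg: "\<And>x. x > 0 \<Longrightarrow> 0 \<le> g x"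
    and v: "v \<in> borel_measurable (lebesgue_on {0<..})" and v_nonneg: "\<And>x. x > 0 \<Longrightarrow> 0 \<le> v x"
    and u: "u \<in> borel_measurable (lebesgue_on {0<..})"
    and fin: "\<And>r. r > 0 \<Longrightarrow> (\<integral>\<^sup>+x\<in>{r<..}. ennreal (g x) \<partial>lebesgue) < \<infinity>"
    and cond: "\<And>r. r > 0 \<Longrightarrow>
        ennpow (\<integral>\<^sup>+x\<in>{r<..}. ennpow (ennreal (v x)) (1 - conj_exp p) \<partial>lebesgue) (1 / conj_exp p)
          * ennpow (\<integral>\<^sup>+y\<in>{1/r<..}. ennreal (u y) \<partial>lebesgue) (1 / q) \<le> ennreal A"
  shows "(\<integral>\<^sup>+y\<in>{0<..}. ennreal (u y) * ennpow (\<integral>\<^sup>+x\<in>{1/y<..}. ennreal (g x) \<partial>lebesgue) q \<partial>lebesgue)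
     \<le> ennreal ((4 * A) powr q) * ennpow (\<integral>\<^sup>+x\<in>{0<..}. ennreal (v x * g x powr p) \<partial>lebesgue) (q / p)"
proof (rule hardy_nested_halfline[OF p pq A g g_nonneg v v_nonneg u])
  have "antimono (\<lambda>r. \<integral>\<^sup>+x\<in>{r<..}. ennreal (g x) \<partial>lebesgue)"
    by (intro antimonoI nn_integral_mono) (auto split: split_indicator)
  then show "(\<lambda>t. \<integral>\<^sup>+x\<in>{1/t<..}. ennreal (g x) \<partial>lebesgue) \<in> borel_measurable (lebesgue_on {0<..})"
    using reciprocal_lebesgue_measurable[of "\<lambda>r. \<integral>\<^sup>+x\<in>{r<..}. ennreal (g x) \<partial>lebesgue"] by simp
next
  fix y c :: real assume y: "0 < y" and c: "0 < c" "ennreal c < (\<integral>\<^sup>+x\<in>{1/y<..}. ennreal (g x) \<partial>lebesgue)"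
  let ?\<phi> = "\<lambda>x. ennreal (g x) * indicator {1/y<..} x"
  have meas [measurable]: "?\<phi> \<in> borel_measurable lebesgue"
    by (rule restrict_halfline_measurable[OF g]) (use y in \<open>auto intro: less_trans[of 0 "1/y"]\<close>)
  obtain T where T: "(\<integral>\<^sup>+x. ?\<phi> x \<partial>lebesgue) = ennreal T" "c < T"
    using fin[of "1/y"] y c by (cases "\<integral>\<^sup>+x. ?\<phi> x \<partial>lebesgue") (auto simp: ennreal_less_iff)
  \<comment> \<open>A tail of mass \<open>c\<close> is the complement of an initial piece of mass \<open>T - c\<close>.\<close>
  obtain t where t: "(\<integral>\<^sup>+x\<in>{..t}. ?\<phi> x \<partial>lebesgue) = ennreal (T - c)"
    by (rule mass_split[OF meas, of "T - c"]) (use T c in \<open>auto simp: ennreal_less_iff\<close>)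
  have "(\<integral>\<^sup>+x. ?\<phi> x \<partial>lebesgue) = (\<integral>\<^sup>+x. ?\<phi> x * indicator {..t} x + ?\<phi> x * indicator {t<..} x \<partial>lebesgue)"
    by (intro nn_integral_cong) (auto split: split_indicator)
  also have "\<dots> = ennreal (T - c) + (\<integral>\<^sup>+x\<in>{t<..}. ?\<phi> x \<partial>lebesgue)"
    unfolding t[symmetric]
    by (intro nn_integral_add borel_measurable_times_ennreal meas borel_measurable_indicator) simp_all
  finally have "ennreal (T - c) + ennreal c = ennreal (T - c) + (\<integral>\<^sup>+x\<in>{t<..}. ?\<phi> x \<partial>lebesgue)"
    using T c by (simp flip: ennreal_plus)
  then have tail: "(\<integral>\<^sup>+x\<in>{t<..}. ?\<phi> x \<partial>lebesgue) = ennreal c"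
    by (simp add: ennreal_add_left_cancel)
  have ty: "1 / y < t"
  proof (rule ccontr)
    assume "\<not> 1 / y < t"
    then have "(\<integral>\<^sup>+x\<in>{t<..}. ?\<phi> x \<partial>lebesgue) = (\<integral>\<^sup>+x. ?\<phi> x \<partial>lebesgue)"
      by (intro nn_integral_cong) (auto split: split_indicator)
    then show False using tail T c by simp
  qed
  moreover have "0 < t" using ty y by (auto intro: less_trans[of 0 "1/y"])
  ultimately have "(\<integral>\<^sup>+x\<in>{1/(1/t)<..}. ennreal (g x) \<partial>lebesgue) = (\<integral>\<^sup>+x\<in>{t<..}. ?\<phi> x \<partial>lebesgue)"
    by (intro nn_integral_cong) (auto split: split_indicator)
  then show "\<exists>r>0. (\<integral>\<^sup>+x\<in>{1/r<..}. ennreal (g x) \<partial>lebesgue) = ennreal c"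
    using \<open>0 < t\<close> tail by (intro exI[of _ "1/t"]) auto
next
  fix t :: real assume t: "0 < t"
  have "{1/t<..} \<subseteq> {1/r<..} \<longleftrightarrow> t \<le> r" if "0 < r" for r
    using t that by (simp add: field_simps)
  then have eq: "{r \<in> {0<..}. {1/t<..} \<subseteq> {1/r<..}} = {t..}"
    using t by auto
  show "{r \<in> {0<..}. {1/t<..} \<subseteq> {1/r<..}} \<in> sets lebesgue" unfolding eq by simp
  have "(\<integral>\<^sup>+y\<in>{t..}. ennreal (u y) \<partial>lebesgue) = (\<integral>\<^sup>+y\<in>{t<..}. ennreal (u y) \<partial>lebesgue)"
    by (intro nn_integral_cong_AE eventually_mono[OF AE_completion[OF AE_lborel_singleton[of t]]])
      (auto split: split_indicator)
  then show "ennpow (\<integral>\<^sup>+x\<in>{1/t<..}. ennpow (ennreal (v x)) (1 - conj_exp p) \<partial>lebesgue) (1 / conj_exp p)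
      * ennpow (\<integral>\<^sup>+y\<in>{r \<in> {0<..}. {1/t<..} \<subseteq> {1/r<..}}. ennreal (u y) \<partial>lebesgue) (1 / q) \<le> ennreal A"
    unfolding eq using cond[of "1/t"] t by simp
next
  show "{1/t<..} \<subseteq> {0<..}" if "0 < t" for t :: real
    using that by (auto intro: less_trans[of 0 "1/t"])
qed (use fin in auto)

section \<open>Reduction of the transform to the Hardy operators\<close>

lemma min_one_powr_split:
  fixes X Y :: real
  assumes "0 < X" "0 < Y"
  shows "min 1 ((X * Y) powr (-1/2)) \<le> X powr (-1/2) * Y powr (-1/2)"
  using assms by (simp add: powr_mult)

lemma norm_integral_le_nn_integral:
  fixes f :: "'a \<Rightarrow> 'b::{banach, second_countable_topology}"
  shows "ennreal (norm (integral\<^sup>L M f)) \<le> (\<integral>\<^sup>+x. ennreal (norm (f x)) \<partial>M)"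
  by (cases "integrable M f") (auto intro: integral_norm_bound_ennreal simp: not_integrable_integral_eq)

text \<open>
  Of the two bounds in the minimum, \<open>1\<close> is used for \<open>x \<le> 1/y\<close> and the power for
  \<open>x > 1/y\<close>, where it separates the variables.
\<close>

lemma norm_Ftransform_le:
  fixes s w :: "real \<Rightarrow> real" and f :: "real \<Rightarrow> complex"
  assumes s: "\<And>x. x > 0 \<Longrightarrow> s x > 0" "s \<in> borel_measurable (lebesgue_on {0<..})"
    and w: "\<And>x. x > 0 \<Longrightarrow> w x > 0"
    and f: "f \<in> borel_measurable (lebesgue_on {0<..})"
    and B: "0 < B" "\<And>x y. x > 0 \<Longrightarrow> y > 0 \<Longrightarrow> norm (K x y) \<le> B * min 1 ((s x * w y) powr (-1/2))"
    and y: "0 < y"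
  shows "ennreal (norm (Ftransform s K f y)) \<le>
    ennreal B * ((\<integral>\<^sup>+x\<in>{0<..1/y}. ennreal (norm (complex_of_real (s x) * f x)) \<partial>lebesgue)
      + ennreal (w y powr (-1/2)) *
        (\<integral>\<^sup>+x\<in>{1/y<..}. ennreal (s x powr (-1/2) * norm (complex_of_real (s x) * f x)) \<partial>lebesgue))"
proof -
  let ?g = "\<lambda>x. norm (complex_of_real (s x) * f x)"
  let ?h = "\<lambda>x. s x powr (-1/2) * ?g x"
  have g: "?g \<in> borel_measurable (lebesgue_on {0<..})"
    using s(2) f by measurable
  have h: "?h \<in> borel_measurable (lebesgue_on {0<..})"
    using s(2) f by measurable
  have sub: "{1/y<..} \<subseteq> {0<..}" using y by (auto intro: less_trans[of 0 "1/y"])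
  have m1: "(\<lambda>x. ennreal (?g x) * indicator {0<..1/y} x) \<in> borel_measurable lebesgue"
    by (rule restrict_halfline_measurable[OF g]) auto
  have m2: "(\<lambda>x. ennreal (?h x) * indicator {1/y<..} x) \<in> borel_measurable lebesgue"
    by (rule restrict_halfline_measurable[OF h]) (use sub in auto)
  have "ennreal (norm (Ftransform s K f y)) \<le>
      (\<integral>\<^sup>+x. ennreal (norm (indicator {0<..} x *\<^sub>R (complex_of_real (s x) * f x * K x y))) \<partial>lebesgue)"
    unfolding Ftransform_def set_lebesgue_integral_def
    by (rule norm_integral_le_nn_integral)
  also have "\<dots> \<le> (\<integral>\<^sup>+x. ennreal B * (ennreal (?g x) * indicator {0<..1/y} x
      + ennreal (w y powr (-1/2)) * (ennreal (?h x) * indicator {1/y<..} x)) \<partial>lebesgue)"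
  proof (intro nn_integral_mono)
    fix x :: real
    consider "x \<le> 0" | "0 < x" "x \<le> 1/y" | "1/y < x" "0 < x" using y sub by fastforce
    then show "ennreal (norm (indicator {0<..} x *\<^sub>R (complex_of_real (s x) * f x * K x y)))
      \<le> ennreal B * (ennreal (?g x) * indicator {0<..1/y} x
      + ennreal (w y powr (-1/2)) * (ennreal (?h x) * indicator {1/y<..} x))"
    proof cases
      case 2
      have "norm (K x y) \<le> B * 1"
        by (rule order_trans[OF B(2)[OF \<open>0 < x\<close> y]]) (use B(1) in \<open>intro mult_left_mono, auto\<close>)
      then have "?g x * norm (K x y) \<le> ?g x * B" by (intro mult_left_mono) auto
      then have "ennreal (?g x * norm (K x y)) \<le> ennreal (B * ?g x)"
        by (intro ennreal_leI) (simp add: mult.commute)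
      then show ?thesis using 2 B(1) by (simp add: norm_mult ennreal_mult)
    next
      case 3
      have "norm (K x y) \<le> B * (s x powr (-1/2) * w y powr (-1/2))"
        by (rule order_trans[OF B(2)[OF \<open>0 < x\<close> y]], rule mult_left_mono[OF min_one_powr_split])
          (use s w y 3 B(1) in auto)
      then have "?g x * norm (K x y) \<le> ?g x * (B * (s x powr (-1/2) * w y powr (-1/2)))"
        by (intro mult_left_mono) auto
      also have "\<dots> = B * (w y powr (-1/2) * ?h x)" by simp
      finally have "ennreal (?g x * norm (K x y)) \<le> ennreal (B * (w y powr (-1/2) * ?h x))"
        by (rule ennreal_leI)
      also have "\<dots> = ennreal B * (ennreal (w y powr (-1/2)) * ennreal (?h x))"
        using B(1) by (simp only: ennreal_mult less_imp_le mult_nonneg_nonneg powr_ge_zero norm_ge_zero)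
      finally show ?thesis using 3 by (simp add: norm_mult)
    qed simp
  qed
  also have "\<dots> = ennreal B * ((\<integral>\<^sup>+x\<in>{0<..1/y}. ennreal (?g x) \<partial>lebesgue)
      + ennreal (w y powr (-1/2)) * (\<integral>\<^sup>+x\<in>{1/y<..}. ennreal (?h x) \<partial>lebesgue))"
    using m1 m2 by (simp add: nn_integral_cmult nn_integral_add)
  finally show ?thesis .
qed

text \<open>
  Admissibility controls the integral of \<open>s \<bar>f\<bar>\<close> on \<open>(0, 1]\<close> and that of
  \<open>s\<^sup>1\<^sup>/\<^sup>2 \<bar>f\<bar>\<close> on \<open>(1, \<infinity>)\<close>.  Moving the cut from \<open>1\<close> to \<open>r\<close> exchanges
  the integrands on the interval between \<open>1\<close> and \<open>r\<close>, which costs a power of \<open>s r\<close>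
  because \<open>s\<close> is nondecreasing.
\<close>

lemma admissible_mass_finite:
  fixes s :: "real \<Rightarrow> real"
  assumes s: "\<And>x. x > 0 \<Longrightarrow> s x > 0" "mono_on {0<..} s"
    and f: "admissible s f" and r: "0 < r"
  shows "(\<integral>\<^sup>+x\<in>{0<..r}. ennreal (norm (complex_of_real (s x) * f x)) \<partial>lebesgue) < \<infinity>" (is "?L < _")
    and "(\<integral>\<^sup>+x\<in>{r<..}. ennreal (s x powr (-1/2) * norm (complex_of_real (s x) * f x)) \<partial>lebesgue) < \<infinity>" (is "?R < _")
proof -
  let ?a = "\<lambda>x. ennreal (s x * norm (f x)) * indicator {0<..1} x"
  let ?b = "\<lambda>x. ennreal (s x powr (1/2) * norm (f x)) * indicator {1<..} x"
  have s_meas: "s \<in> borel_measurable (lebesgue_on {0<..})"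
    using s(2) by (intro borel_imp_lebesgue_on_measurable borel_measurable_mono_on_fnc)
  have f_meas: "f \<in> borel_measurable (lebesgue_on {0<..})" using f by (simp add: admissible_def)
  have a: "?a \<in> borel_measurable lebesgue" "(\<integral>\<^sup>+x. ?a x \<partial>lebesgue) < \<infinity>"
    using f s_meas f_meas by (auto simp: admissible_def intro!: restrict_halfline_measurable)
  have b: "?b \<in> borel_measurable lebesgue" "(\<integral>\<^sup>+x. ?b x \<partial>lebesgue) < \<infinity>"
    using f s_meas f_meas by (auto simp: admissible_def intro!: restrict_halfline_measurable)
  have combine: "(\<integral>\<^sup>+x. ennreal c * ?a x + ennreal d * ?b x \<partial>lebesgue) < \<infinity>" for c d
    using a b by (simp add: nn_integral_cmult nn_integral_add ennreal_mult_less_top)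
  have root: "s x = s x powr (1/2) * s x powr (1/2)" "s x powr (-1/2) * s x = s x powr (1/2)" if "0 < x" for x
    using s(1)[OF that] powr_add[of "s x" "1/2" "1/2"] powr_add[of "s x" "-1/2" 1] by simp_all
  have "?L \<le> (\<integral>\<^sup>+x. ennreal 1 * ?a x + ennreal (s r powr (1/2)) * ?b x \<partial>lebesgue)"
  proof (intro nn_integral_mono)
    fix x :: real
    have "ennreal (s x * norm (f x)) \<le> ennreal (s r powr (1/2)) * ennreal (s x powr (1/2) * norm (f x))"
      if "1 < x" "x \<le> r"
    proof -
      have "s x powr (1/2) \<le> s r powr (1/2)"
        using that s(1)[of x] by (intro powr_mono2 mono_onD[OF s(2)]) auto
      then have "s x powr (1/2) * (s x powr (1/2) * norm (f x)) \<le> s r powr (1/2) * (s x powr (1/2) * norm (f x))"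
        by (intro mult_right_mono) auto
      then show ?thesis
        using root(1)[of x] that by (simp add: ennreal_leI mult.assoc[symmetric] flip: ennreal_mult)
    qed
    then show "ennreal (norm (complex_of_real (s x) * f x)) * indicator {0<..r} x
        \<le> ennreal 1 * ?a x + ennreal (s r powr (1/2)) * ?b x"
      using s(1)[of x] by (auto simp: norm_mult split: split_indicator)
  qed
  then show "?L < \<infinity>" using combine[of 1 "s r powr (1/2)"] by (rule le_less_trans)
  have "?R \<le> (\<integral>\<^sup>+x. ennreal (s r powr (-1/2)) * ?a x + ennreal 1 * ?b x \<partial>lebesgue)"
  proof (intro nn_integral_mono)
    fix x :: real
    have "ennreal (s x powr (-1/2) * (s x * norm (f x))) \<le> ennreal (s r powr (-1/2)) * ennreal (s x * norm (f x))"
      if "r < x"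
    proof -
      have "s x powr (-1/2) \<le> s r powr (-1/2)"
        using that r s(1) by (intro powr_mono2' mono_onD[OF s(2)]) auto
      then show ?thesis
        using s(1)[of x] that r by (simp add: ennreal_leI mult_right_mono flip: ennreal_mult)
    qed
    moreover have "s x powr (-1/2) * (s x * norm (f x)) = s x powr (1/2) * norm (f x)" if "r < x"
      using root(2)[of x] that r by (simp add: mult.assoc[symmetric])
    ultimately show "ennreal (s x powr (-1/2) * norm (complex_of_real (s x) * f x)) * indicator {r<..} x
        \<le> ennreal (s r powr (-1/2)) * ?a x + ennreal 1 * ?b x"
      using s(1)[of x] r by (auto simp: norm_mult mult.assoc[symmetric] split: split_indicator)
  qed
  then show "?R < \<infinity>" using combine[of "s r powr (-1/2)" 1] by (rule le_less_trans)
qed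

section \<open>The weighted norm inequality\<close>

theorem corollary1p3:
  fixes s w u v :: "real \<Rightarrow> real" and K :: "real \<Rightarrow> real \<Rightarrow> complex" and p q C :: real
  assumes s_pos: "\<And>x. x > 0 \<Longrightarrow> s x > 0"
    and w_pos: "\<And>x. x > 0 \<Longrightarrow> w x > 0"
    and s_mono: "mono_on {0<..} s"
    and w_mono: "mono_on {0<..} w"
    and s_loc_int: "\<And>r. r > 0 \<Longrightarrow> set_integrable lebesgue {0<..r} s"
    and K_cont: "continuous_on ({0<..} \<times> {0<..}) (\<lambda>(x, y). K x y)"
    and K_bound: "\<exists>B>0. \<forall>x>0. \<forall>y>0. norm (K x y) \<le> B * min 1 ((s x * w y) powr (-1/2))"
    and pq: "1 < p" "p \<le> q"
    and u_meas: "u \<in> borel_measurable (lebesgue_on {0<..})"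
    and v_meas: "v \<in> borel_measurable (lebesgue_on {0<..})"
    and u_nonneg: "\<And>x. x > 0 \<Longrightarrow> u x \<ge> 0"
    and v_nonneg: "\<And>x. x > 0 \<Longrightarrow> v x \<ge> 0"
    and sw: "\<exists>a>0. \<exists>b>0. \<forall>x>0. a \<le> s x * w (1/x) \<and> s x * w (1/x) \<le> b"
    and C_pos: "C > 0"
    and weights:
      "(SUP r\<in>{0<..}.
          ennpow
            ((\<integral>\<^sup>+x\<in>{0<..r}. ennpow (ennreal (v x)) (1 - conj_exp p) \<partial>lebesgue) +
             ennreal (s r powr (conj_exp p / 2)) *
               (\<integral>\<^sup>+x\<in>{r<..}. ennpow (ennreal (v x)) (1 - conj_exp p) *
                   ennreal (s x powr (- conj_exp p / 2)) \<partial>lebesgue))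
            (1 / conj_exp p) *
          ennpow
            (ennreal (w (1/r) powr (q/2)) *
               (\<integral>\<^sup>+y\<in>{1/r<..}. ennreal (u y * w y powr (- q/2)) \<partial>lebesgue) +
             (\<integral>\<^sup>+y\<in>{0<..1/r}. ennreal (u y) \<partial>lebesgue))
            (1 / q))
        \<le> ennreal C"
  shows "\<exists>c>0. \<forall>f. admissible s f \<longrightarrow>
           wnorm q u (Ftransform s K f) \<le> ennreal c * wnorm p v (\<lambda>x. complex_of_real (s x) * f x)"
proof -
  define p' where "p' = conj_exp p"
  note c = conj_exp_props[OF pq(1), folded p'_def]
  have q: "1 < q" using pq by simp
  obtain B where B: "0 < B" "\<And>x y. x > 0 \<Longrightarrow> y > 0 \<Longrightarrow> norm (K x y) \<le> B * min 1 ((s x * w y) powr (-1/2))"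
    using K_bound by blast
  obtain a where a: "0 < a" "\<And>x. x > 0 \<Longrightarrow> a \<le> s x * w (1/x)" using sw by blast
  have s_meas [measurable]: "s \<in> borel_measurable (lebesgue_on {0<..})"
    using s_mono by (intro borel_imp_lebesgue_on_measurable borel_measurable_mono_on_fnc)
  have w_meas [measurable]: "w \<in> borel_measurable (lebesgue_on {0<..})"
    using w_mono by (intro borel_imp_lebesgue_on_measurable borel_measurable_mono_on_fnc)
  note [measurable] = u_meas v_meas
  define V1 where "V1 r = (\<integral>\<^sup>+x\<in>{0<..r}. ennpow (ennreal (v x)) (1 - p') \<partial>lebesgue)" for r
  define V2 where "V2 r = (\<integral>\<^sup>+x\<in>{r<..}. ennpow (ennreal (v x)) (1 - p') * ennreal (s x powr (- p' / 2)) \<partial>lebesgue)" for r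
  define U1 where "U1 r = (\<integral>\<^sup>+y\<in>{0<..1/r}. ennreal (u y) \<partial>lebesgue)" for r
  define U2 where "U2 r = (\<integral>\<^sup>+y\<in>{1/r<..}. ennreal (u y * w y powr (- q/2)) \<partial>lebesgue)" for r
  have both: "ennpow (V1 r + ennreal (s r powr (p'/2)) * V2 r) (1/p')
      * ennpow (ennreal (w (1/r) powr (q/2)) * U2 r + U1 r) (1/q) \<le> ennreal C" if "0 < r" for r
    using weights that unfolding SUP_le_iff V1_def V2_def U1_def U2_def p'_def by auto
  have cond1: "ennpow (V1 r) (1/p') * ennpow (U1 r) (1/q) \<le> ennreal C" if "0 < r" for r
    by (rule order_trans[OF _ both[OF that]], intro mult_mono ennpow_mono) (use c q in auto)
  \<comment> \<open>In the product of the two weighted terms the factors \<open>s r\<close> and \<open>w (1/r)\<close> combine to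
    the square root of \<open>s r * w (1/r)\<close>, which is at least the square root of \<open>a\<close>.\<close>
  define A where "A = C / a powr (1/2)"
  have "0 < A" using C_pos a by (simp add: A_def)
  have cond2: "ennpow (V2 r) (1/p') * ennpow (U2 r) (1/q) \<le> ennreal A" if r: "0 < r" for r
  proof -
    let ?Z = "ennpow (V2 r) (1/p') * ennpow (U2 r) (1/q)"
    have pos: "0 < s r" "0 < w (1/r)" using s_pos w_pos r by auto
    have "ennreal (a powr (1/2)) * ?Z \<le> ennreal ((s r * w (1/r)) powr (1/2)) * ?Z"
      using a r by (intro mult_right_mono ennreal_leI powr_mono2) auto
    also have "\<dots> = ennpow (ennreal (s r powr (p'/2)) * V2 r) (1/p')
        * ennpow (ennreal (w (1/r) powr (q/2)) * U2 r) (1/q)"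
      using pos c q by (simp add: ennpow_cmult powr_powr powr_mult ennreal_mult) (simp add: mult_ac)
    also have "\<dots> \<le> ennreal C"
      by (rule order_trans[OF _ both[OF r]], intro mult_mono ennpow_mono) (use c q in auto)
    finally have le: "ennreal (a powr (1/2)) * ?Z \<le> ennreal C" .
    have "?Z = ennreal (1 / a powr (1/2)) * (ennreal (a powr (1/2)) * ?Z)"
      using a by (simp add: mult.assoc[symmetric] flip: ennreal_mult)
    also have "\<dots> \<le> ennreal (1 / a powr (1/2)) * ennreal C" by (intro mult_left_mono le) simp
    also have "\<dots> = ennreal A" using C_pos a by (simp add: A_def flip: ennreal_mult)
    finally show ?thesis .
  qed
  define c0 where "c0 = (2 * B) powr q * ((4 * C) powr q + (4 * A) powr q)"
  have "0 < c0" using B C_pos \<open>0 < A\<close> by (auto simp: c0_def intro!: mult_pos_pos add_pos_pos)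
  show ?thesis
  proof (intro exI[of _ "c0 powr (1/q)"] conjI allI impI)
    fix f assume f: "admissible s f"
    have f_meas [measurable]: "f \<in> borel_measurable (lebesgue_on {0<..})"
      using f by (simp add: admissible_def)
    let ?g = "\<lambda>x. norm (complex_of_real (s x) * f x)"
    let ?h = "\<lambda>x. s x powr (-1/2) * ?g x"
    let ?v = "\<lambda>x. v x * s x powr (p/2)"
    let ?u = "\<lambda>y. u y * w y powr (-q/2)"
    define G1 where "G1 y = (\<integral>\<^sup>+x\<in>{0<..1/y}. ennreal (?g x) \<partial>lebesgue)" for y
    define G2 where "G2 y = (\<integral>\<^sup>+x\<in>{1/y<..}. ennreal (?h x) \<partial>lebesgue)" for y
    define T where "T = (\<integral>\<^sup>+x\<in>{0<..}. ennreal (v x * ?g x powr p) \<partial>lebesgue)"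
    \<comment> \<open>The weights \<open>?v\<close> and \<open>?u\<close> absorb the powers of \<open>s\<close> and \<open>w\<close>: \<open>?v\<close> times
      \<open>?h\<close> to the power \<open>p\<close> is \<open>v\<close> times \<open>?g\<close> to the power \<open>p\<close>, and
      \<open>?v\<close> to the power \<open>1 - p'\<close> is the weight in \<open>V2\<close>.\<close>
    have I1: "(\<integral>\<^sup>+y\<in>{0<..}. ennreal (u y) * ennpow (G1 y) q \<partial>lebesgue) \<le> ennreal ((4 * C) powr q) * ennpow T (q/p)"
      unfolding G1_def T_def
      by (rule hardy_lower[OF pq C_pos])
        (use admissible_mass_finite(1)[OF s_pos s_mono f] cond1 v_nonneg in \<open>auto simp: V1_def U1_def p'_def\<close>)
    have "(\<integral>\<^sup>+y\<in>{0<..}. ennreal (?u y) * ennpow (G2 y) q \<partial>lebesgue)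
        \<le> ennreal ((4 * A) powr q) * ennpow (\<integral>\<^sup>+x\<in>{0<..}. ennreal (?v x * ?h x powr p) \<partial>lebesgue) (q/p)"
      unfolding G2_def
    proof (rule hardy_upper[OF pq \<open>0 < A\<close>])
      fix r :: real assume r: "0 < r"
      have "(\<integral>\<^sup>+x\<in>{r<..}. ennpow (ennreal (?v x)) (1 - p') \<partial>lebesgue) = V2 r"
        unfolding V2_def
      proof (intro nn_integral_cong)
        fix x :: real
        have "ennpow (ennreal (?v x)) (1 - p') = ennpow (ennreal (v x)) (1 - p') * ennreal (s x powr (- p' / 2))"
          if "r < x"
        proof -
          have sx: "0 < s x" and vx: "0 \<le> v x" using s_pos v_nonneg that r by auto
          show ?thesis
          proof (cases "v x = 0")
            case True
            then show ?thesis using c(3) sx by (simp add: ennpow_def ennreal_top_mult)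
          next
            case False
            have "?v x powr (1 - p') = v x powr (1 - p') * s x powr (p * (1 - p') / 2)"
              using sx vx by (simp add: powr_mult powr_powr)
            then show ?thesis using False sx vx c(5)
              by (simp add: ennpow_ennreal_pos flip: ennreal_mult)
          qed
        qed
        then show "ennpow (ennreal (?v x)) (1 - p') * indicator {r<..} x
            = ennpow (ennreal (v x)) (1 - p') * ennreal (s x powr (- p' / 2)) * indicator {r<..} x"
          by (auto split: split_indicator)
      qed
      then show "ennpow (\<integral>\<^sup>+x\<in>{r<..}. ennpow (ennreal (?v x)) (1 - conj_exp p) \<partial>lebesgue) (1 / conj_exp p)
          * ennpow (\<integral>\<^sup>+y\<in>{1/r<..}. ennreal (?u y) \<partial>lebesgue) (1 / q) \<le> ennreal A"
        using cond2[OF r] by (simp add: U2_def p'_def)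
    qed (use admissible_mass_finite(2)[OF s_pos s_mono f] v_nonneg in \<open>auto\<close>)
    also have "(\<integral>\<^sup>+x\<in>{0<..}. ennreal (?v x * ?h x powr p) \<partial>lebesgue) = T"
      unfolding T_def
    proof (intro nn_integral_cong)
      fix x :: real
      have "?v x * ?h x powr p = v x * ?g x powr p" if "0 < x"
      proof -
        have "s x powr (p/2) * s x powr (- (p/2)) = 1"
          using s_pos[OF that] by (simp add: powr_add[symmetric])
        then show ?thesis using s_pos[OF that] by (simp add: powr_mult powr_powr)
      qed
      then show "ennreal (?v x * ?h x powr p) * indicator {0<..} x = ennreal (v x * ?g x powr p) * indicator {0<..} x"
        by (auto simp: mult.assoc split: split_indicator)
    qed
    finally have I2: "(\<integral>\<^sup>+y\<in>{0<..}. ennreal (?u y) * ennpow (G2 y) q \<partial>lebesgue) \<le> ennreal ((4 * A) powr q) * ennpow T (q/p)" .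
    have all: "(\<integral>\<^sup>+x. F x \<partial>lebesgue_on {0<..}) = (\<integral>\<^sup>+x\<in>{0<..}. F x \<partial>lebesgue)" for F :: "real \<Rightarrow> ennreal"
      by (simp add: nn_integral_restrict_space)
    have [measurable]: "G1 \<in> borel_measurable (lebesgue_on {0<..})"
      unfolding G1_def
      by (rule reciprocal_lebesgue_measurable[of "\<lambda>r. \<integral>\<^sup>+x\<in>{0<..r}. ennreal (?g x) \<partial>lebesgue"])
        (auto intro!: monoI nn_integral_mono split: split_indicator)
    have [measurable]: "G2 \<in> borel_measurable (lebesgue_on {0<..})"
      unfolding G2_def
      by (rule reciprocal_lebesgue_measurable[of "\<lambda>r. \<integral>\<^sup>+x\<in>{r<..}. ennreal (?h x) \<partial>lebesgue"])
        (auto intro!: antimonoI nn_integral_mono split: split_indicator)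
    have "(\<integral>\<^sup>+y\<in>{0<..}. ennreal (u y * norm (Ftransform s K f y) powr q) \<partial>lebesgue)
        \<le> (\<integral>\<^sup>+y. ennreal ((2 * B) powr q) * (ennreal (u y) * ennpow (G1 y) q + ennreal (?u y) * ennpow (G2 y) q) \<partial>lebesgue_on {0<..})"
      unfolding all[symmetric]
    proof (intro nn_integral_mono)
      fix y :: real assume "y \<in> space (lebesgue_on {0<..})"
      then have y: "0 < y" by simp
      have "ennreal (norm (Ftransform s K f y) powr q) = ennpow (ennreal (norm (Ftransform s K f y))) q"
        using q by (simp add: ennpow_ennreal)
      also have "\<dots> \<le> ennpow (ennreal B * (G1 y + ennreal (w y powr (-1/2)) * G2 y)) q"
        unfolding G1_def G2_def
        by (intro ennpow_mono norm_Ftransform_le s_pos w_pos s_meas f_meas B y) (use q in auto)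
      also have "\<dots> \<le> ennreal ((2 * B) powr q) * (ennpow (G1 y) q + ennpow (ennreal (w y powr (-1/2)) * G2 y) q)"
        by (rule ennpow_add_le) (use B q in auto)
      also have "ennpow (ennreal (w y powr (-1/2)) * G2 y) q = ennreal (w y powr (-q/2)) * ennpow (G2 y) q"
        using w_pos[OF y] q by (simp add: ennpow_cmult powr_powr)
      finally have "ennreal (u y) * ennreal (norm (Ftransform s K f y) powr q) \<le> ennreal (u y) *
          (ennreal ((2 * B) powr q) * (ennpow (G1 y) q + ennreal (w y powr (-q/2)) * ennpow (G2 y) q))"
        by (rule mult_left_mono) simp
      then show "ennreal (u y * norm (Ftransform s K f y) powr q) \<le>
          ennreal ((2 * B) powr q) * (ennreal (u y) * ennpow (G1 y) q + ennreal (?u y) * ennpow (G2 y) q)"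
        using u_nonneg[OF y] by (simp add: ennreal_mult distrib_left mult_ac)
    qed
    also have "\<dots> = ennreal ((2 * B) powr q) *
        ((\<integral>\<^sup>+y\<in>{0<..}. ennreal (u y) * ennpow (G1 y) q \<partial>lebesgue) + (\<integral>\<^sup>+y\<in>{0<..}. ennreal (?u y) * ennpow (G2 y) q \<partial>lebesgue))"
      unfolding all[symmetric] by (simp add: nn_integral_cmult nn_integral_add)
    also have "\<dots> \<le> ennreal ((2 * B) powr q) *
        (ennreal ((4 * C) powr q) * ennpow T (q/p) + ennreal ((4 * A) powr q) * ennpow T (q/p))"
      by (intro mult_left_mono add_mono I1 I2) simp
    also have "\<dots> = ennreal c0 * ennpow T (q/p)"
      by (simp add: c0_def ennreal_mult distrib_right mult.assoc)
    finally have "ennpow (\<integral>\<^sup>+y\<in>{0<..}. ennreal (u y * norm (Ftransform s K f y) powr q) \<partial>lebesgue) (1/q)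
        \<le> ennpow (ennreal c0 * ennpow T (q/p)) (1/q)"
      by (rule ennpow_mono) (use q in simp)
    also have "\<dots> = ennreal (c0 powr (1/q)) * ennpow T (1/p)"
      using \<open>0 < c0\<close> q pq by (simp add: ennpow_cmult ennpow_ennpow)
    finally show "wnorm q u (Ftransform s K f) \<le> ennreal (c0 powr (1/q)) * wnorm p v (\<lambda>x. complex_of_real (s x) * f x)"
      unfolding wnorm_def T_def .
  qed (use \<open>0 < c0\<close> in simp)
qed

end
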